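(* Let $\mathcal H$ be a real Hilbert space, $A:\mathcal H\to\mathcal H$ single-valued and continuously differentiable, $B:\mathcal H\rightrightarrows 2^{\mathcal H}$ maximal monotone, and suppose the solution set $\mathcal S=\{x: 0\in (A+B)(x)\}$ is nonempty and closed. Consider a sequence $\{x_t\}$ generated by the inexact damped Newton-like scheme described in the context with parameters $c>0$ and $\nu,\rho\ge 0$. Assume that for some $\epsilon>0$, $\kappa>0$ and $q>0$ the error bound $$\operatorname{dist}(x,\mathcal S)\le \kappa\, r(x)^q\qquad \forall x\in V:=\{x : r(x)\le \epsilon\}$$ holds, and that within $V$, $A$ is $L$-Lipschitz continuous for some $L\ge 0$ and $\nabla A$ is $p$-Hölder continuous for some $p\in(0,1]$ (i.e. $\|\nabla A(x)-\nabla A(y)\|\le \zeta\|x-y\|^p$ for all $x,y\in V$, for some $\zeta\ge0$). Suppose that either $$\text{(i)}\quad (1+\rho)q>1,\quad (1+p)q>1,\quad (q+pq-\rho)(1+p)>1,$$ or $$\text{(ii)}\quad (1+p)q>1,\quad (q+pq-\rho)(1+p)>1,\quad \rho+q>1,\quad \rho>0,$$ and that $r_0$ is sufficiently small. Then $\{x_t\}$ converges strongly to some point $x^*\in\mathcal S$.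
   Context: Notation: $\mathrm{Id}$ is the identity on $\mathcal H$; $R(x):=x-(\mathrm{Id}+B)^{-1}(\mathrm{Id}-A)(x)$, $r(x):=\|R(x)\|$, so that $\mathcal S=\{x: R(x)=0\}$; $\operatorname{dist}(x,\mathcal S)$ is the distance from $x$ to $\mathcal S$; $r_t:=r(x_t)$. The scheme: at iterate $x_t$, put $\mu_t:=c\,r(x_t)^\rho$, and $H_t:=\mu_t\mathrm{Id}+J_t$, where $J_t$ is a bounded linear operator on $\mathcal H$ that is positive semidefinite ($\langle J_t v,v\rangle\ge 0$ for all $v$) but possibly non-Hermitian and satisfies $\|J_t-\nabla A(x_t)\|=O(r(x_t)^\theta)$ for some $\theta\ge\rho$ (with constant independent of $t$). Define the subproblem residual $$\hat r_t(x):=\left\|x-(\mathrm{Id}+B)^{-1}\big((\mathrm{Id}-H_t)(x)+(H_t-A)(x_t)\big)\right\|,$$ which vanishes at the exact step $(H_t+B)^{-1}(H_t-A)(x_t)$. The next iterate $x_{t+1}$ is any point satisfying $\hat r_t(x_{t+1})\le \nu\, r(x_t)^{1+\rho}$. The iteration is stopped if $r(x_t)=0$ (then $x_t\in\mathcal S$, and the sequence is regarded as constant from then on), so $r(x_t)>0$ whenever a step is taken. *)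

theory Defs
  imports "HOL-Analysis.Analysis"
begin

text \<open>A set-valued operator \<open>B : H \<rightrightarrows> 2\<^sup>H\<close> is a function \<open>B :: 'a \<Rightarrow> 'a set\<close>; the pointwise
  order on such functions is inclusion of graphs.\<close>

definition monotone_operator :: "('a::real_inner \<Rightarrow> 'a set) \<Rightarrow> bool" where
  "monotone_operator B \<longleftrightarrow> (\<forall>x y. \<forall>u\<in>B x. \<forall>v\<in>B y. 0 \<le> (u - v) \<bullet> (x - y))"

definition maximal_monotone :: "('a::real_inner \<Rightarrow> 'a set) \<Rightarrow> bool" where
  "maximal_monotone B \<longleftrightarrow>
     monotone_operator B \<and> (\<forall>C. monotone_operator C \<and> B \<le> C \<longrightarrow> C = B)"

definition op_sum :: "('a::real_inner \<Rightarrow> 'a) \<Rightarrow> ('a \<Rightarrow> 'a set) \<Rightarrow> 'a \<Rightarrow> 'a set" where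
  "op_sum A B x = {A x + b | b. b \<in> B x}"

definition solution_set :: "('a::real_inner \<Rightarrow> 'a) \<Rightarrow> ('a \<Rightarrow> 'a set) \<Rightarrow> 'a set" where
  "solution_set A B = {x. 0 \<in> op_sum A B x}"

text \<open>\<open>(Id + B)\<^sup>-\<^sup>1\<close> as a function. For maximal monotone \<open>B\<close> on a Hilbert space the point
  described exists and is unique for every \<open>y\<close> (Minty).\<close>

definition resolvent :: "('a::real_inner \<Rightarrow> 'a set) \<Rightarrow> 'a \<Rightarrow> 'a" where
  "resolvent B y = (THE x. y \<in> op_sum id B x)"

definition residual_map :: "('a::real_inner \<Rightarrow> 'a) \<Rightarrow> ('a \<Rightarrow> 'a set) \<Rightarrow> 'a \<Rightarrow> 'a" where
  "residual_map A B x = x - resolvent B (x - A x)"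

definition residual :: "('a::real_inner \<Rightarrow> 'a) \<Rightarrow> ('a \<Rightarrow> 'a set) \<Rightarrow> 'a \<Rightarrow> real" where
  "residual A B x = norm (residual_map A B x)"

definition subproblem_residual ::
  "('a::real_inner \<Rightarrow> 'a) \<Rightarrow> ('a \<Rightarrow> 'a set) \<Rightarrow> ('a \<Rightarrow>\<^sub>L 'a) \<Rightarrow> 'a \<Rightarrow> 'a \<Rightarrow> real" where
  "subproblem_residual A B H z x =
     norm (x - resolvent B ((x - H x) + (H z - A z)))"

definition psd_operator :: "('a::real_inner \<Rightarrow>\<^sub>L 'a) \<Rightarrow> bool" where
  "psd_operator J \<longleftrightarrow> (\<forall>v. 0 \<le> J v \<bullet> v)"

definition damped_operator ::
  "('a::real_inner \<Rightarrow> 'a) \<Rightarrow> ('a \<Rightarrow> 'a set) \<Rightarrow> real \<Rightarrow> real \<Rightarrow> ('a \<Rightarrow>\<^sub>L 'a) \<Rightarrow> 'a \<Rightarrow> ('a \<Rightarrow>\<^sub>L 'a)" where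
  "damped_operator A B c \<rho> J z = (c * residual A B z powr \<rho>) *\<^sub>R id_blinfun + J"

text \<open>\<open>A'\<close> is the derivative of \<open>A\<close>, and \<open>K\<close> is the constant in
  \<open>\<parallel>J\<^sub>t - \<nabla>A(x\<^sub>t)\<parallel> = O(r(x\<^sub>t)\<^sup>\<theta>)\<close>. Once the residual vanishes the iteration is stopped
  and \<open>J t\<close> is unconstrained; otherwise the residual is positive, so the Isabelle convention
  \<open>0 powr 0 = 0\<close> never enters.\<close>

definition damped_newton_sequence ::
  "('a::real_inner \<Rightarrow> 'a) \<Rightarrow> ('a \<Rightarrow> ('a \<Rightarrow>\<^sub>L 'a)) \<Rightarrow> ('a \<Rightarrow> 'a set) \<Rightarrow>
     real \<Rightarrow> real \<Rightarrow> real \<Rightarrow> real \<Rightarrow> real \<Rightarrow> (nat \<Rightarrow> 'a \<Rightarrow>\<^sub>L 'a) \<Rightarrow> (nat \<Rightarrow> 'a) \<Rightarrow> bool" where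
  "damped_newton_sequence A A' B c \<nu> \<rho> \<theta> K J x \<longleftrightarrow>
     (\<forall>t. if residual A B (x t) = 0 then x (Suc t) = x t
          else psd_operator (J t) \<and>
               norm (J t - A' (x t)) \<le> K * residual A B (x t) powr \<theta> \<and>
               subproblem_residual A B (damped_operator A B c \<rho> (J t) (x t)) (x t) (x (Suc t))
                 \<le> \<nu> * residual A B (x t) powr (1 + \<rho>))"

end

theory Submission
  imports Defs
begin

text \<open>Write \<open>r\<close> for the residual at the current iterate. Testing monotonicity of \<open>B\<close> at the inexact
  step against a nearly closest solution, and absorbing the cross terms with the damping
  \<open>\<mu> = c * r powr \<rho>\<close>, bounds the step length by a multiple of \<open>r powr m\<close>, where \<open>m > 0\<close> is the
  minimum of \<open>q\<close>, \<open>1\<close> and \<open>q + p * q - \<rho>\<close>. The new residual is then at most a multiple of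
  \<open>r powr (1 + \<rho>) + r powr (\<rho> + m) + r powr ((1 + p) * m)\<close>. Under (ii) all three exponents exceed
  1, so the residuals decay geometrically and the steps are summable. Since the residual is at most
  a multiple of the distance to the solution set, \<open>q > 1\<close> forces small residuals to vanish, and for
  \<open>q \<le> 1\<close> condition (i) implies (ii). Short segments that start at a small residual stay
  in \<open>V\<close>, so \<open>V\<close> need not be convex.\<close>

section \<open>Resolvents of maximal monotone operators\<close>

text \<open>For two graph points monotonicity reads \<open>x \<bullet> v + y \<bullet> u \<le> x
  \<bullet> u + y \<bullet> v\<close>. With \<open>(y, v)\<close> fixed this is affine in the lifted
  point \<open>(x, u, x \<bullet> u)\<close>, so it passes to the convex hull, first in one argument
  and then in the other. Pairing a hull point with itself gives the claim.\<close>

lemma inner_le_of_convex_hull_monotone_graph: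
  fixes G :: "('a::real_inner \<times> 'a) set"
  assumes mono: "\<And>x u y v. (x, u) \<in> G \<Longrightarrow> (y, v) \<in> G \<Longrightarrow> 0 \<le> (u - v) \<bullet> (x - y)"
    and z: "(x, u, s) \<in> convex hull ((\<lambda>(x, u). (x, u, x \<bullet> u)) ` G)"
  shows "x \<bullet> u \<le> s"
proof -
  let ?P = "(\<lambda>(x, u). (x, u, x \<bullet> u)) ` G"
  have one: "x \<bullet> v + y \<bullet> u \<le> s + y \<bullet> v"
    if "(y, v) \<in> G" "(x, u, s) \<in> convex hull ?P" for x u y v s
  proof -
    have "convex hull ?P \<subseteq> {z. (v, y, -1) \<bullet> z \<le> y \<bullet> v}"
    proof (rule hull_minimal)
      show "?P \<subseteq> {z. (v, y, -1) \<bullet> z \<le> y \<bullet> v}"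
        using mono[OF _ that(1)] by (auto simp: inner_diff inner_commute algebra_simps)
    qed (rule convex_halfspace_le)
    with that(2) show ?thesis by (auto simp: inner_commute algebra_simps)
  qed
  have "convex hull ?P \<subseteq> {z. (u, x, -1) \<bullet> z \<le> s}"
  proof (rule hull_minimal)
    show "?P \<subseteq> {z. (u, x, -1) \<bullet> z \<le> s}"
      using one[OF _ z] by (auto simp: inner_commute algebra_simps)
  qed (rule convex_halfspace_le)
  with z show ?thesis by (auto simp: inner_commute algebra_simps)
qed

text \<open>Divide by \<open>t\<close> and let \<open>t\<close> tend to 0. This extracts the
  first-order optimality condition at a supremum.\<close>

lemma nonpos_of_le_mult_small:
  fixes D C :: real
  assumes "\<And>t. 0 < t \<Longrightarrow> t \<le> 1 \<Longrightarrow> t * D \<le> t\<^sup>2 * C"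
  shows "D \<le> 0"
proof (rule tendsto_lowerbound)
  show "((\<lambda>t. t * C) \<longlongrightarrow> 0) (at_right 0)"
    by (auto intro!: tendsto_eq_intros)
  show "\<forall>\<^sub>F t in at_right 0. D \<le> t * C"
    unfolding eventually_at_right_field
  proof (intro exI[of _ 1] conjI allI impI)
    fix t :: real assume "0 < t" "t < 1"
    with assms[of t] show "D \<le> t * C" by (simp add: power2_eq_square)
  qed simp
qed simp

text \<open>The points \<open>x\<close> are those where all \<open>f\<^sub>i x = (x - y\<^sub>i) \<bullet> (x + v\<^sub>i)\<close> are nonpositive. Below,
  \<open>\<phi>\<close> is the dual function, the minimum over \<open>x\<close> of the corresponding convex combination of the
  \<open>f\<^sub>i\<close>, attained at \<open>x = - w / 2\<close>. It is nonpositive by monotonicity and strongly concave in \<open>w\<close>,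
  so \<open>w\<close> converges along maximizing sequences even though no maximizer need exist.\<close>

lemma monotone_graph_extends_along_antidiagonal:
  fixes G :: "('a::{real_inner,complete_space} \<times> 'a) set"
  assumes mono: "\<And>x u y v. (x, u) \<in> G \<Longrightarrow> (y, v) \<in> G \<Longrightarrow> 0 \<le> (u - v) \<bullet> (x - y)"
    and "G \<noteq> {}"
  shows "\<exists>x. \<forall>(y, v) \<in> G. 0 \<le> (v + x) \<bullet> (y - x)"
proof -
  \<comment> \<open>The third coordinate averages \<open>y \<bullet> v\<close>, minus the constant
    term of \<open>f\<^sub>i\<close>; \<open>w\<close> averages \<open>v - y\<close>, the
    coefficient of its linear term.\<close>
  define P where "P = convex hull ((\<lambda>(x, u). (x, u, x \<bullet> u)) ` G)"
  define w where "w z = fst (snd z) - fst z" for z :: "'a \<times> 'a \<times> real"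
  define \<phi> where "\<phi> z = - (norm (w z))\<^sup>2 / 4 - snd (snd z)" for z
  have P_conv: "(1 - t) *\<^sub>R z + t *\<^sub>R z' \<in> P" if "z \<in> P" "z' \<in> P" "0 \<le> t" "t \<le> 1" for z z' t
    unfolding P_def using that by (intro convexD[OF convex_convex_hull]) (auto simp: P_def)
  have w_conv: "w ((1 - t) *\<^sub>R z + t *\<^sub>R z') = (1 - t) *\<^sub>R w z + t *\<^sub>R w z'" for t z z'
    by (simp add: w_def algebra_simps)
  have \<phi>_conv: "\<phi> ((1 - t) *\<^sub>R z + t *\<^sub>R z')
      = (1 - t) * \<phi> z + t * \<phi> z' + t * (1 - t) * (norm (w z - w z'))\<^sup>2 / 4" for t z z'
    unfolding \<phi>_def w_conv
    by (simp add: power2_norm_eq_inner inner_simps inner_commute algebra_simps)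
       (simp add: field_simps)
  have \<phi>_nonpos: "\<phi> z \<le> 0" if "z \<in> P" for z
  proof (cases z)
    case (fields x u s)
    have "x \<bullet> u \<le> s"
      using inner_le_of_convex_hull_monotone_graph[OF mono] that unfolding P_def fields by blast
    moreover have "(norm (u - x))\<^sup>2 = (norm (u + x))\<^sup>2 - 4 * (x \<bullet> u)"
      by (simp add: power2_norm_eq_inner inner_simps inner_commute)
    ultimately show ?thesis
      unfolding \<phi>_def w_def fields fst_conv snd_conv using zero_le_power2[of "norm (u + x)"] by linarith
  qed
  define \<Gamma> where "\<Gamma> = (SUP z\<in>P. \<phi> z)"
  have bdd: "bdd_above (\<phi> ` P)" using \<phi>_nonpos by (auto intro!: bdd_aboveI[of _ 0])
  have P_ne: "P \<noteq> {}" using \<open>G \<noteq> {}\<close> by (simp add: P_def)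
  have \<phi>_le: "\<phi> z \<le> \<Gamma>" if "z \<in> P" for z
    unfolding \<Gamma>_def using that bdd by (rule cSUP_upper)
  have \<Gamma>_nonpos: "\<Gamma> \<le> 0"
    unfolding \<Gamma>_def using P_ne \<phi>_nonpos by (rule cSUP_least)
  have "\<exists>z\<in>P. \<Gamma> - inverse (real (Suc n)) < \<phi> z" for n
    using less_cSUP_iff[OF P_ne bdd, of "\<Gamma> - inverse (real (Suc n))"] by (simp add: \<Gamma>_def)
  then obtain z where zP: "\<And>n. z n \<in> P" and z: "\<And>n. \<Gamma> - inverse (real (Suc n)) < \<phi> (z n)"
    by metis
  have \<phi>_lim: "(\<lambda>n. \<phi> (z n)) \<longlonglongrightarrow> \<Gamma>"
  proof (rule tendsto_sandwich)
    show "(\<lambda>n. \<Gamma> - inverse (real (Suc n))) \<longlonglongrightarrow> \<Gamma>"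
      using tendsto_diff[OF tendsto_const LIMSEQ_inverse_real_of_nat] by simp
    show "\<forall>\<^sub>F n in sequentially. \<Gamma> - inverse (real (Suc n)) \<le> \<phi> (z n)"
      using z less_imp_le by (intro always_eventually) blast
    show "\<forall>\<^sub>F n in sequentially. \<phi> (z n) \<le> \<Gamma>" using \<phi>_le zP by simp
  qed simp
  \<comment> \<open>Strong concavity at the midpoint: the value there exceeds the mean of the two
    values by a sixteenth of the squared distance, yet is at most \<open>\<Gamma>\<close>.\<close>
  have close: "(norm (w (z m) - w (z n)))\<^sup>2 \<le> 8 * (\<Gamma> - \<phi> (z m)) + 8 * (\<Gamma> - \<phi> (z n))" for m n
    using \<phi>_le[OF P_conv[OF zP zP, of "1/2" m n]] unfolding \<phi>_conv by simp
  have "Cauchy (\<lambda>n. w (z n))"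
  proof (rule metric_CauchyI)
    fix e :: real assume "e > 0"
    have "\<forall>\<^sub>F n in sequentially. \<Gamma> - e\<^sup>2 / 16 < \<phi> (z n)"
      using \<phi>_lim \<open>e > 0\<close> by (intro order_tendstoD(1)) auto
    then obtain N where N: "\<And>n. n \<ge> N \<Longrightarrow> \<Gamma> - e\<^sup>2 / 16 < \<phi> (z n)"
      by (auto simp: eventually_sequentially)
    have "dist (w (z m)) (w (z n)) < e" if "m \<ge> N" "n \<ge> N" for m n
    proof (rule power_less_imp_less_base)
      show "(dist (w (z m)) (w (z n)))\<^sup>2 < e\<^sup>2"
        using close[of m n] N[OF that(1)] N[OF that(2)] unfolding dist_norm
        by (simp add: field_simps)
    qed (use \<open>e > 0\<close> in auto)
    then show "\<exists>M. \<forall>m\<ge>M. \<forall>n\<ge>M. dist (w (z m)) (w (z n)) < e" by blast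
  qed
  then obtain W where W: "(\<lambda>n. w (z n)) \<longlonglongrightarrow> W"
    by (auto simp: Cauchy_convergent_iff convergent_def)
  have "0 \<le> (v + (- (1/2) *\<^sub>R W)) \<bullet> (y - (- (1/2) *\<^sub>R W))" if "(y, v) \<in> G" for y v
  proof -
    define z' where "z' = (y, v, y \<bullet> v)"
    have z'P: "z' \<in> P" unfolding P_def z'_def using that by (intro hull_inc) auto
    \<comment> \<open>\<open>D\<close> is the first-order gain in moving from the maximizing
      sequence towards \<open>z'\<close>. No such move can raise the value above
      \<open>\<Gamma>\<close>.\<close>
    define D where "D = \<phi> z' - \<Gamma> + (norm (W - w z'))\<^sup>2 / 4"
    have "t * D \<le> t\<^sup>2 * ((norm (W - w z'))\<^sup>2 / 4)" if "0 < t" "t \<le> 1" for t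
    proof -
      have "(1 - t) * \<Gamma> + t * \<phi> z' + t * (1 - t) * (norm (W - w z'))\<^sup>2 / 4 \<le> \<Gamma>"
      proof (rule tendsto_upperbound)
        show "(\<lambda>n. (1 - t) * \<phi> (z n) + t * \<phi> z' + t * (1 - t) * (norm (w (z n) - w z'))\<^sup>2 / 4)
            \<longlonglongrightarrow> (1 - t) * \<Gamma> + t * \<phi> z' + t * (1 - t) * (norm (W - w z'))\<^sup>2 / 4"
          by (intro tendsto_intros \<phi>_lim W) simp
        show "\<forall>\<^sub>F n in sequentially. (1 - t) * \<phi> (z n) + t * \<phi> z'
            + t * (1 - t) * (norm (w (z n) - w z'))\<^sup>2 / 4 \<le> \<Gamma>"
          using \<phi>_le[OF P_conv[OF zP z'P, of t]] that unfolding \<phi>_conv by simp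
      qed simp
      then show ?thesis by (simp add: D_def field_simps power2_eq_square)
    qed
    then have "D \<le> 0" by (rule nonpos_of_le_mult_small)
    \<comment> \<open>The left side equals the function \<open>f\<^sub>i\<close> of the pair
      \<open>(y, v)\<close>, evaluated at \<open>- W / 2\<close>.\<close>
    then have "\<phi> z' + (norm (W - w z'))\<^sup>2 / 4 \<le> 0" using \<Gamma>_nonpos by (simp add: D_def)
    then show ?thesis
      by (simp add: \<phi>_def w_def z'_def power2_norm_eq_inner inner_simps inner_commute field_simps)
  qed
  then show ?thesis by blast
qed

section \<open>Minty's theorem and nonexpansive resolvents\<close>

lemma maximal_monotone_memI:
  assumes "maximal_monotone B" and "\<And>y v. v \<in> B y \<Longrightarrow> 0 \<le> (v - u) \<bullet> (y - x)"
  shows "u \<in> B x"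
proof -
  \<comment> \<open>Adjoin the pair \<open>(x, u)\<close> to the graph; the enlarged operator is
    still monotone, so maximality says that nothing was added.\<close>
  let ?C = "B(x := insert u (B x))"
  have "monotone_operator ?C"
    unfolding monotone_operator_def
  proof (intro allI ballI)
    fix a b v w assume "v \<in> ?C a" "w \<in> ?C b"
    moreover have "(v - w) \<bullet> (a - b) = (w - v) \<bullet> (b - a)"
      by (simp add: inner_simps)
    moreover have "0 \<le> (v - w) \<bullet> (a - b)" if "v \<in> B a" "w \<in> B b"
      using assms(1) that unfolding maximal_monotone_def monotone_operator_def by blast
    ultimately show "0 \<le> (v - w) \<bullet> (a - b)"
      using assms(2)[of v a] assms(2)[of w b] by (auto split: if_splits)
  qed
  moreover have "B \<le> ?C" by (auto simp: le_fun_def)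
  ultimately have "?C = B" using assms(1) unfolding maximal_monotone_def by blast
  then show ?thesis by (metis fun_upd_same insertI1)
qed

lemma maximal_monotoneD:
  assumes "maximal_monotone B" "u \<in> B x" "v \<in> B y"
  shows "0 \<le> (u - v) \<bullet> (x - y)"
  using assms unfolding maximal_monotone_def monotone_operator_def by blast

text \<open>Shift the graph by \<open>- y\<close> in the second coordinate. The extension lemma
  gives an \<open>x\<close> for which \<open>(x, - x)\<close> is monotonically related to the
  shifted graph, that is, \<open>(x, y - x)\<close> to the graph of \<open>B\<close>, and maximality
  puts that pair into the graph.\<close>

lemma Minty:
  fixes B :: "'a::{real_inner,complete_space} \<Rightarrow> 'a set"
  assumes "maximal_monotone B"
  shows "\<exists>x. y - x \<in> B x"
proof -
  define G where "G = {(a, u - y) | a u. u \<in> B a}"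
  \<comment> \<open>Were the graph empty, every pair would be vacuously related to it and hence
    belong to it.\<close>
  have "G \<noteq> {}"
    using maximal_monotone_memI[OF assms] unfolding G_def by blast
  have G_mono: "0 \<le> (u - v) \<bullet> (a - b)" if G: "(a, u) \<in> G" "(b, v) \<in> G" for a u b v
    using maximal_monotoneD[OF assms, of "u + y" a "v + y" b] G by (auto simp: G_def)
  obtain x where x: "\<forall>(a, v) \<in> G. 0 \<le> (v + x) \<bullet> (a - x)"
    using monotone_graph_extends_along_antidiagonal[OF G_mono \<open>G \<noteq> {}\<close>] by blast
  have "y - x \<in> B x"
  proof (rule maximal_monotone_memI[OF assms])
    fix a v assume "v \<in> B a"
    then have "0 \<le> ((v - y) + x) \<bullet> (a - x)" using x unfolding G_def by blast
    then show "0 \<le> (v - (y - x)) \<bullet> (a - x)" by (simp add: algebra_simps)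
  qed
  then show ?thesis ..
qed

lemma resolvent_eqI:
  assumes "maximal_monotone B" "y - x \<in> B x"
  shows "resolvent B y = x"
  unfolding resolvent_def
proof (rule the_equality)
  show "y \<in> op_sum id B x" using assms(2) by (auto simp: op_sum_def intro!: exI[of _ "y - x"])
  fix x' assume "y \<in> op_sum id B x'"
  then have "y - x' \<in> B x'" by (auto simp: op_sum_def)
  from maximal_monotoneD[OF assms(1) this assms(2)]
  have "(x' - x) \<bullet> (x' - x) \<le> 0" by (simp add: inner_simps inner_commute algebra_simps)
  then show "x' = x" by (metis eq_iff_diff_eq_0 inner_eq_zero_iff inner_ge_zero order_antisym)
qed

lemma resolvent_mem:
  fixes B :: "'a::{real_inner,complete_space} \<Rightarrow> 'a set"
  assumes "maximal_monotone B"
  shows "y - resolvent B y \<in> B (resolvent B y)"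
  using Minty[OF assms] resolvent_eqI[OF assms] by metis

lemma resolvent_nonexpansive:
  fixes B :: "'a::{real_inner,complete_space} \<Rightarrow> 'a set"
  assumes "maximal_monotone B"
  shows "norm (resolvent B y - resolvent B y') \<le> norm (y - y')"
proof -
  let ?d = "resolvent B y - resolvent B y'"
  \<comment> \<open>Firm nonexpansiveness: monotonicity of \<open>B\<close> at the two resolvent
    points.\<close>
  have "(norm ?d)\<^sup>2 \<le> (y - y') \<bullet> ?d"
    using maximal_monotoneD[OF assms resolvent_mem[OF assms, of y] resolvent_mem[OF assms, of y']]
    by (simp add: power2_norm_eq_inner inner_simps inner_commute algebra_simps)
  also have "\<dots> \<le> norm (y - y') * norm ?d" by (rule norm_cauchy_schwarz)
  finally show ?thesis by (simp add: power2_eq_square)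
       (metis mult_right_le_imp_le norm_ge_zero order_le_less)
qed

section \<open>The residual and one inexact step\<close>

lemma mem_solution_set_iff: "x \<in> solution_set A B \<longleftrightarrow> - A x \<in> B x"
  by (auto simp: solution_set_def op_sum_def add_eq_0_iff)

lemma residual_eq_0_iff:
  fixes B :: "'a::{real_inner,complete_space} \<Rightarrow> 'a set"
  assumes "maximal_monotone B"
  shows "residual A B x = 0 \<longleftrightarrow> x \<in> solution_set A B"
proof -
  have "resolvent B (x - A x) = x \<longleftrightarrow> - A x \<in> B x"
    using resolvent_mem[OF assms, of "x - A x"] resolvent_eqI[OF assms, of "x - A x" x]
    by (metis diff_diff_eq2 add_diff_cancel_left' diff_conv_add_uminus)
  then show ?thesis
    by (auto simp: residual_def residual_map_def mem_solution_set_iff)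
qed

text \<open>The distance \<open>norm (x - y)\<close> counts twice: once directly, and once inside
  the argument of the nonexpansive resolvent.\<close>

lemma residual_le_perturb:
  fixes B :: "'a::{real_inner,complete_space} \<Rightarrow> 'a set"
  assumes "maximal_monotone B"
  shows "residual A B x \<le> residual A B y + 2 * norm (x - y) + norm (A x - A y)"
proof -
  let ?res = "\<lambda>z. resolvent B (z - A z)"
  have "norm (x - ?res x) \<le> norm (y - ?res y) + norm (x - y) + norm (?res x - ?res y)"
    using norm_triangle_ineq[of "y - ?res y" "(x - y) - (?res x - ?res y)"]
      norm_triangle_ineq4[of "x - y" "?res x - ?res y"] by simp
  moreover have "norm (?res x - ?res y) \<le> norm (x - y) + norm (A x - A y)"
    using resolvent_nonexpansive[OF assms, of "x - A x" "y - A y"]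
      norm_triangle_ineq4[of "x - y" "A x - A y"] by (simp add: algebra_simps)
  ultimately show ?thesis by (simp add: residual_def residual_map_def)
qed

lemma residual_nonneg: "0 \<le> residual A B x"
  by (simp add: residual_def)

lemma continuous_on_residual:
  fixes B :: "'a::{real_inner,complete_space} \<Rightarrow> 'a set"
  assumes "maximal_monotone B" "continuous_on UNIV A"
  shows "continuous_on UNIV (residual A B)"
proof -
  have "1-lipschitz_on UNIV (resolvent B)"
    using resolvent_nonexpansive[OF assms(1)] by (auto intro!: lipschitz_onI simp: dist_norm)
  then have "continuous_on UNIV (resolvent B)" by (rule lipschitz_on_continuous_on)
  then have "continuous_on UNIV (\<lambda>x. resolvent B (x - A x))"
    by (rule continuous_on_compose2) (use assms(2) in \<open>auto intro: continuous_intros\<close>)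
  then show ?thesis
    unfolding residual_def residual_map_def by (intro continuous_intros)
qed

text \<open>Here \<open>s\<close> is the step, \<open>w\<close> the displacement from the iterate to
  a solution, \<open>e\<close> the inexactness and \<open>\<eta>\<close> the linearization error.
  Expanding in \<open>v = s - w\<close> and dropping the nonnegative \<open>J v \<bullet> v\<close>
  leaves a quadratic inequality
  \<open>(norm v)\<^sup>2 \<le> \<beta> * norm v + \<beta> * \<beta>\<close>. It gives
  \<open>norm v \<le> 2 * \<beta>\<close>, and \<open>norm w \<le> \<beta>\<close> makes the factor
  3.\<close>

lemma regularized_step_bound:
  fixes J :: "'a::real_inner \<Rightarrow>\<^sub>L 'a"
  assumes psd: "psd_operator J" and M: "norm J \<le> M" and "0 < \<mu>"
    and mono: "0 \<le> (e + \<eta> - \<mu> *\<^sub>R s - J (s - w)) \<bullet> (s - w - e)"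
  shows "norm s \<le> 3 * (norm w + norm e + ((1 + M) * norm e + norm \<eta>) / \<mu>)"
proof -
  define v where "v = s - w"
  define \<beta> where "\<beta> = norm w + norm e + ((1 + M) * norm e + norm \<eta>) / \<mu>"
  have M0: "0 \<le> M" using M norm_ge_zero order_trans by blast
  have s: "s = v + w" by (simp add: v_def)
  have "\<mu> * (v \<bullet> v) \<le> e \<bullet> v + \<eta> \<bullet> v - e \<bullet> e - \<eta> \<bullet> e - J v \<bullet> v + J v \<bullet> e
      - \<mu> * (w \<bullet> v) + \<mu> * (v \<bullet> e) + \<mu> * (w \<bullet> e)"
    using mono unfolding s by (simp add: inner_simps algebra_simps)
  also have "\<dots> \<le> norm e * norm v + norm \<eta> * norm v + norm \<eta> * norm e + M * norm v * norm e
      + \<mu> * (norm w * norm v) + \<mu> * (norm v * norm e) + \<mu> * (norm w * norm e)"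
  proof -
    have "J v \<bullet> e \<le> norm (J v) * norm e" by (rule norm_cauchy_schwarz)
    also have "\<dots> \<le> M * norm v * norm e"
      using norm_blinfun[of J v] mult_right_mono[OF M, of "norm v"]
      by (intro mult_right_mono) (linarith | simp)+
    finally have "J v \<bullet> e \<le> M * norm v * norm e" .
    moreover have "0 \<le> J v \<bullet> v" using psd by (simp add: psd_operator_def)
    moreover have "- (\<eta> \<bullet> e) \<le> norm \<eta> * norm e"
      using norm_cauchy_schwarz[of "-\<eta>" e] by simp
    moreover have "\<mu> * - (w \<bullet> v) \<le> \<mu> * (norm w * norm v)"
      using norm_cauchy_schwarz[of "-w" v] \<open>0 < \<mu>\<close> by (intro mult_left_mono) auto
    moreover have "\<mu> * (v \<bullet> e) \<le> \<mu> * (norm v * norm e)" "\<mu> * (w \<bullet> e) \<le> \<mu> * (norm w * norm e)"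
      using \<open>0 < \<mu>\<close> by (simp_all add: norm_cauchy_schwarz)
    moreover have "0 \<le> e \<bullet> e" by simp
    ultimately show ?thesis
      using norm_cauchy_schwarz[of e v] norm_cauchy_schwarz[of \<eta> v] by linarith
  qed
  also have "\<dots> = \<mu> * (\<beta> * norm v + norm e * (norm w + norm \<eta> / \<mu>))"
    using \<open>0 < \<mu>\<close> by (simp add: \<beta>_def field_simps)
  finally have "(norm v)\<^sup>2 \<le> \<beta> * norm v + norm e * (norm w + norm \<eta> / \<mu>)"
    using \<open>0 < \<mu>\<close> by (simp add: power2_norm_eq_inner)
  also have "norm e * (norm w + norm \<eta> / \<mu>) \<le> \<beta> * \<beta>"
    using \<open>0 < \<mu>\<close> M0 by (intro mult_mono) (auto simp: \<beta>_def add_divide_distrib)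
  finally have "(norm v)\<^sup>2 \<le> \<beta> * norm v + \<beta> * \<beta>" by simp
  \<comment> \<open>If \<open>norm v\<close> exceeded \<open>2 * \<beta>\<close>, both factors would
    be positive, while the quadratic inequality makes the product nonpositive.\<close>
  moreover have "(norm v - 2 * \<beta>) * (norm v + \<beta>) = (norm v)\<^sup>2 - \<beta> * norm v - 2 * (\<beta> * \<beta>)"
    by (simp add: power2_eq_square algebra_simps)
  moreover have "0 \<le> \<beta> * \<beta>" by simp
  ultimately have "(norm v - 2 * \<beta>) * (norm v + \<beta>) \<le> 0" by linarith
  moreover have "0 \<le> \<beta>" "norm w \<le> \<beta>" using \<open>0 < \<mu>\<close> M0 by (auto simp: \<beta>_def)
  ultimately have "norm v \<le> 2 * \<beta>"
    using mult_pos_pos[of "norm v - 2 * \<beta>" "norm v + \<beta>"] by fastforce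
  then show ?thesis
    using norm_triangle_ineq[of v w] \<open>norm w \<le> \<beta>\<close> unfolding s \<beta>_def[symmetric] by linarith
qed

lemma Cauchy_of_summable_steps:
  fixes x :: "nat \<Rightarrow> 'a::real_normed_vector"
  assumes "\<And>n. norm (x (Suc n) - x n) \<le> b n" and "summable b"
  shows "Cauchy x"
proof -
  have le: "norm (x n - x m) \<le> sum b {m..<n}" if "m \<le> n" for m n
    using that
  proof (induction rule: dec_induct)
    case (step n)
    have "norm (x (Suc n) - x m) \<le> norm (x (Suc n) - x n) + norm (x n - x m)"
      by norm
    with step assms(1)[of n] show ?case by simp
  qed simp
  show ?thesis
  proof (rule CauchyI')
    fix e :: real assume "0 < e"
    then obtain N where N: "\<forall>m\<ge>N. \<forall>n. norm (sum b {m..<n}) < e"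
      using assms(2) unfolding summable_Cauchy by blast
    show "\<exists>M. \<forall>m\<ge>M. \<forall>n>m. dist (x m) (x n) < e"
    proof (intro exI allI impI)
      fix m n assume "N \<le> m" "m < n"
      then have "norm (sum b {m..<n}) < e" using N by blast
      then show "dist (x m) (x n) < e"
        using le[of m n] \<open>m < n\<close> by (simp add: dist_norm norm_minus_commute)
    qed
  qed
qed

section \<open>Local estimates on the sublevel set of the residual\<close>

locale residual_sublevel =
  fixes A :: "'a::{real_inner,complete_space} \<Rightarrow> 'a"
    and A' :: "'a \<Rightarrow> 'a \<Rightarrow>\<^sub>L 'a" and B :: "'a \<Rightarrow> 'a set" and \<epsilon> L \<zeta> p :: real
  assumes max_mono: "maximal_monotone B"
    and deriv: "(A has_derivative blinfun_apply (A' x)) (at x)"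
    and \<epsilon>_pos: "0 < \<epsilon>" and L_nonneg: "0 \<le> L"
    and lipschitz: "L-lipschitz_on {x. residual A B x \<le> \<epsilon>} A"
    and p_pos: "0 < p" and \<zeta>_nonneg: "0 \<le> \<zeta>"
    and holder: "residual A B x \<le> \<epsilon> \<Longrightarrow> residual A B y \<le> \<epsilon> \<Longrightarrow>
          norm (A' x - A' y) \<le> \<zeta> * norm (x - y) powr p"
begin

abbreviation r where "r \<equiv> residual A B"

lemma continuous_on_r: "continuous_on UNIV r"
proof (rule continuous_on_residual[OF max_mono])
  show "continuous_on UNIV A"
    using deriv by (intro has_derivative_continuous_on[of UNIV A "\<lambda>x. blinfun_apply (A' x)"])
qed

lemma norm_A_diff_le: "r x \<le> \<epsilon> \<Longrightarrow> r y \<le> \<epsilon> \<Longrightarrow> norm (A x - A y) \<le> L * norm (x - y)"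
  using lipschitz_onD[OF lipschitz] by (auto simp: dist_norm)

lemma r_lipschitz: "r x \<le> \<epsilon> \<Longrightarrow> r y \<le> \<epsilon> \<Longrightarrow> r x \<le> r y + (2 + L) * norm (x - y)"
  using residual_le_perturb[OF max_mono, of A x y] norm_A_diff_le[of x y]
  by (simp add: algebra_simps)

text \<open>The Lipschitz bound on \<open>r\<close> holds only inside the sublevel set, so it cannot
  be applied to \<open>y\<close> at once. If \<open>y\<close> lay outside, the intermediate value
  theorem would give a point on the segment with \<open>r\<close> exactly \<open>\<epsilon>\<close>,
  and the bound at that point is contradictory.\<close>

lemma r_le_near:
  assumes x: "r x \<le> \<epsilon> / 2" and y: "(2 + L) * norm (y - x) < \<epsilon> / 2"
  shows "r y \<le> \<epsilon>"
proof (rule ccontr)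
  assume "\<not> r y \<le> \<epsilon>"
  have "\<exists>t\<ge>0. t \<le> 1 \<and> r (x + t *\<^sub>R (y - x)) = \<epsilon>"
  proof (rule IVT')
    show "continuous_on {0..1} (\<lambda>t. r (x + t *\<^sub>R (y - x)))"
      by (intro continuous_on_compose2[OF continuous_on_r] continuous_intros) auto
  qed (use x \<epsilon>_pos \<open>\<not> r y \<le> \<epsilon>\<close> in auto)
  then obtain t where t: "0 \<le> t" "t \<le> 1" "r (x + t *\<^sub>R (y - x)) = \<epsilon>" by blast
  have "\<epsilon> \<le> r x + (2 + L) * (t * norm (y - x))"
    using r_lipschitz[of "x + t *\<^sub>R (y - x)" x] t x \<epsilon>_pos by simp
  also have "t * norm (y - x) \<le> norm (y - x)"
    using t by (simp add: mult_left_le_one_le)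
  finally show False using x y L_nonneg by (simp add: mult_left_mono)
qed

lemma closed_segment_subset_sublevel:
  assumes x: "r x \<le> \<epsilon> / 2" and y: "(2 + L) * norm (y - x) < \<epsilon> / 2"
  shows "closed_segment x y \<subseteq> {z. r z \<le> \<epsilon>}"
proof clarify
  fix z assume "z \<in> closed_segment x y"
  then have "norm (z - x) \<le> norm (y - x)"
    using segment_bound1 by blast
  then have "(2 + L) * norm (z - x) \<le> (2 + L) * norm (y - x)"
    using L_nonneg by (intro mult_left_mono) auto
  then show "r z \<le> \<epsilon>" using r_le_near[OF x] y by force
qed

text \<open>By \<open>r_le_near\<close>, the margin \<open>\<epsilon> / 2\<close> puts a ball around
  \<open>x\<close> inside the sublevel set, so small difference quotients of \<open>A\<close> are
  bounded by \<open>L\<close>.\<close>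

lemma norm_derivative_le:
  assumes x: "r x \<le> \<epsilon> / 2"
  shows "norm (A' x) \<le> L"
proof (rule norm_blinfun_bound[OF L_nonneg])
  fix v show "norm (A' x v) \<le> L * norm v"
  proof (cases "v = 0")
    case False
    have "norm (A' x v) / norm v \<le> L"
    proof (rule field_le_epsilon)
      fix e :: real assume "0 < e"
      then obtain d where "0 < d" and d: "\<And>y. norm (y - x) < d \<Longrightarrow>
          norm (A y - A x - A' x (y - x)) \<le> e * norm (y - x)"
        using deriv[of x] unfolding has_derivative_at_alt by blast
      \<comment> \<open>The increment \<open>h *\<^sub>R v\<close> has length \<open>k / 2\<close>,
        strictly below both the differentiability radius and the radius that keeps it in the
        sublevel set.\<close>
      define k where "k = min d (\<epsilon> / 2 / (2 + L))"
      define h where "h = k / (2 * norm v)"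
      have "0 < k" "k \<le> d" "k \<le> \<epsilon> / 2 / (2 + L)"
        using \<open>0 < d\<close> \<epsilon>_pos L_nonneg by (simp_all add: k_def)
      moreover have "h * norm v = k / 2" using False by (simp add: h_def)
      ultimately have h: "h * norm v < d" "h * norm v < \<epsilon> / 2 / (2 + L)" by linarith+
      have "0 < h" using \<open>0 < k\<close> False by (simp add: h_def)
      have "norm (A (x + h *\<^sub>R v) - A x) \<le> L * (h * norm v)"
        using norm_A_diff_le[of "x + h *\<^sub>R v" x] r_le_near[OF x, of "x + h *\<^sub>R v"] x h \<open>0 < h\<close> \<epsilon>_pos L_nonneg
        by (simp add: field_simps)
      moreover have "norm (A (x + h *\<^sub>R v) - A x - A' x (h *\<^sub>R v)) \<le> e * (h * norm v)"
        using d[of "x + h *\<^sub>R v"] h \<open>0 < h\<close> by simp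
      ultimately have "norm (A' x (h *\<^sub>R v)) \<le> L * (h * norm v) + e * (h * norm v)"
        using norm_triangle_sub[of "A' x (h *\<^sub>R v)" "A (x + h *\<^sub>R v) - A x"]
        by (simp add: norm_minus_commute)
      then have "h * norm (A' x v) \<le> h * ((L + e) * norm v)"
        using \<open>0 < h\<close> by (simp add: blinfun.scaleR_right algebra_simps)
      then have "norm (A' x v) \<le> (L + e) * norm v"
        using \<open>0 < h\<close> by (rule mult_left_le_imp_le)
      then show "norm (A' x v) / norm v \<le> L + e"
        using False by (simp add: pos_divide_le_eq)
    qed
    then show ?thesis using False by (simp add: field_simps)
  qed simp
qed

text \<open>The mean value inequality for \<open>A\<close> minus its linearization at
  \<open>x\<close>, with the Holder bound on the derivative replaced by its largest value on the
  segment.\<close>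

lemma taylor_holder:
  assumes seg: "closed_segment x y \<subseteq> {z. r z \<le> \<epsilon>}"
  shows "norm (A y - A x - A' x (y - x)) \<le> \<zeta> * norm (y - x) powr (1 + p)"
proof -
  have "norm (A y - A x - A' x (y - x)) \<le> norm (y - x) * (\<zeta> * norm (y - x) powr p)"
  proof (rule differentiable_bound_linearization[where f' = "\<lambda>z. blinfun_apply (A' z)" and ?x0.0 = x])
    show "x + t *\<^sub>R (y - x) \<in> closed_segment x y" if "t \<in> {0..1}" for t
      using that by (auto simp: in_segment algebra_simps)
    show "(A has_derivative blinfun_apply (A' z)) (at z within closed_segment x y)" for z
      using deriv by (rule has_derivative_at_withinI)
    show "onorm (blinfun_apply (A' z) - blinfun_apply (A' x)) \<le> \<zeta> * norm (y - x) powr p"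
      if z: "z \<in> closed_segment x y" for z
    proof -
      have "norm (A' z - A' x) \<le> \<zeta> * norm (z - x) powr p"
        using seg z by (intro holder) auto
      also have "\<dots> \<le> \<zeta> * norm (y - x) powr p"
        using segment_bound1[OF z] \<zeta>_nonneg p_pos by (intro mult_left_mono powr_mono2) auto
      finally show ?thesis
        by (simp add: norm_blinfun.rep_eq minus_blinfun.rep_eq fun_diff_def)
    qed
  qed auto
  then show ?thesis by (simp add: powr_add powr_one' mult_ac)
qed

text \<open>The resolvent value \<open>y\<close> near \<open>z'\<close> carries an explicit element
  of \<open>B y\<close>. Monotonicity against \<open>- A s \<in> B s\<close> is the hypothesis of
  \<open>regularized_step_bound\<close>, with \<open>W\<close> bounding the distance to the solution
  \<open>s\<close> and \<open>E\<close> the inexactness.\<close>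

lemma newton_step_length:
  assumes z: "r z \<le> \<epsilon> / 2"
    and J: "psd_operator J" "norm (J - A' z) \<le> \<gamma>" and "0 < \<mu>"
    and sub: "subproblem_residual A B (\<mu> *\<^sub>R id_blinfun + J) z z' \<le> E"
    and s: "s \<in> solution_set A B" "(2 + L) * norm (s - z) < \<epsilon> / 2" "norm (s - z) \<le> W"
  shows "norm (z' - z) \<le> 3 * (W + E + ((1 + L + \<gamma>) * E + (\<zeta> * W powr (1 + p) + \<gamma> * W)) / \<mu>)"
proof -
  define H where "H = \<mu> *\<^sub>R id_blinfun + J"
  have H: "H v = \<mu> *\<^sub>R v + J v" for v
    by (simp add: H_def blinfun.add_left blinfun.scaleR_left)
  define y where "y = resolvent B ((z' - H z') + (H z - A z))"
  define e where "e = z' - y"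
  define \<eta> where "\<eta> = A s - A z - J (s - z)"
  have \<gamma>: "0 \<le> \<gamma>" using J(2) norm_ge_zero order_trans by blast
  have W: "0 \<le> W" using s(3) norm_ge_zero order_trans by blast
  have e: "norm e \<le> E" using sub by (simp add: subproblem_residual_def e_def y_def H_def)
  have y: "(z' - H z') + (H z - A z) - y \<in> B y"
    unfolding y_def by (rule resolvent_mem[OF max_mono])
  have "- A s \<in> B s" using s(1) by (simp add: mem_solution_set_iff)
  have "0 \<le> ((z' - H z') + (H z - A z) - y - (- A s)) \<bullet> (y - s)"
    using max_mono y \<open>- A s \<in> B s\<close> by (rule maximal_monotoneD)
  also have "(z' - H z') + (H z - A z) - y - (- A s)
      = e + \<eta> - \<mu> *\<^sub>R (z' - z) - J ((z' - z) - (s - z))"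
    by (simp add: e_def \<eta>_def H blinfun.diff_right algebra_simps)
  also have "y - s = (z' - z) - (s - z) - e" by (simp add: e_def)
  finally have mono: "0 \<le> (e + \<eta> - \<mu> *\<^sub>R (z' - z) - J ((z' - z) - (s - z)))
      \<bullet> ((z' - z) - (s - z) - e)" .
  have "norm J \<le> L + \<gamma>"
    using norm_derivative_le[OF z] J(2) norm_triangle_sub[of J "A' z"] by linarith
  from regularized_step_bound[OF J(1) this \<open>0 < \<mu>\<close> mono]
  have "norm (z' - z) \<le> 3 * (norm (s - z) + norm e + ((1 + (L + \<gamma>)) * norm e + norm \<eta>) / \<mu>)" .
  also have "\<dots> \<le> 3 * (W + E + ((1 + (L + \<gamma>)) * E + (\<zeta> * W powr (1 + p) + \<gamma> * W)) / \<mu>)"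
  proof -
    have "norm \<eta> \<le> norm (A s - A z - A' z (s - z)) + norm ((A' z - J) (s - z))"
      using norm_triangle_ineq[of "A s - A z - A' z (s - z)" "(A' z - J) (s - z)"]
      by (simp add: \<eta>_def blinfun.diff_left)
    also have "\<dots> \<le> \<zeta> * norm (s - z) powr (1 + p) + \<gamma> * norm (s - z)"
    proof (rule add_mono)
      show "norm (A s - A z - A' z (s - z)) \<le> \<zeta> * norm (s - z) powr (1 + p)"
        by (intro taylor_holder closed_segment_subset_sublevel z s(2))
      have "norm ((A' z - J) (s - z)) \<le> norm (A' z - J) * norm (s - z)" by (rule norm_blinfun)
      also have "\<dots> \<le> \<gamma> * norm (s - z)"
        using J(2) by (simp add: norm_minus_commute mult_right_mono)
      finally show "norm ((A' z - J) (s - z)) \<le> \<gamma> * norm (s - z)" .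
    qed
    also have "\<dots> \<le> \<zeta> * W powr (1 + p) + \<gamma> * W"
      using s(3) \<gamma> \<zeta>_nonneg p_pos by (intro add_mono mult_left_mono powr_mono2) auto
    finally have "norm \<eta> \<le> \<zeta> * W powr (1 + p) + \<gamma> * W" .
    then show ?thesis
      using s(3) e \<gamma> L_nonneg \<open>0 < \<mu>\<close>
      by (intro mult_left_mono add_mono divide_right_mono) auto
  qed
  finally show ?thesis by (simp add: add.assoc)
qed

text \<open>The subproblem residual and \<open>r z'\<close> apply the resolvent to two points whose
  difference is the error of the damped linear model,
  \<open>A z' - A z - H (z' - z)\<close>.\<close>

lemma newton_step_residual:
  assumes z: "r z \<le> \<epsilon> / 2"
    and J: "norm (J - A' z) \<le> \<gamma>" and "0 < \<mu>"
    and sub: "subproblem_residual A B (\<mu> *\<^sub>R id_blinfun + J) z z' \<le> E"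
    and d: "(2 + L) * norm (z' - z) < \<epsilon> / 2"
  shows "r z' \<le> E + (\<mu> + \<gamma>) * norm (z' - z) + \<zeta> * norm (z' - z) powr (1 + p)"
proof -
  define H where "H = \<mu> *\<^sub>R id_blinfun + J"
  have H: "H v = \<mu> *\<^sub>R v + J v" for v
    by (simp add: H_def blinfun.add_left blinfun.scaleR_left)
  define a where "a = (z' - H z') + (H z - A z)"
  have "norm (z' - resolvent B a) \<le> E"
    using sub by (simp add: subproblem_residual_def a_def H_def)
  then have "r z' \<le> E + norm (a - (z' - A z'))"
    using resolvent_nonexpansive[OF max_mono, of a "z' - A z'"]
      norm_triangle_ineq[of "z' - resolvent B a" "resolvent B a - resolvent B (z' - A z')"]
    by (simp add: residual_def residual_map_def)
  also have "a - (z' - A z') = (A z' - A z - A' z (z' - z)) + (A' z - J) (z' - z) - \<mu> *\<^sub>R (z' - z)"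
    by (simp add: a_def H blinfun.diff_left blinfun.diff_right algebra_simps)
  also have "norm \<dots> \<le> \<zeta> * norm (z' - z) powr (1 + p) + \<gamma> * norm (z' - z) + \<mu> * norm (z' - z)"
  proof (rule order_trans[OF norm_triangle_ineq4 add_mono[OF order_trans[OF norm_triangle_ineq add_mono]]])
    show "norm (A z' - A z - A' z (z' - z)) \<le> \<zeta> * norm (z' - z) powr (1 + p)"
      by (intro taylor_holder closed_segment_subset_sublevel z d)
    have "norm ((A' z - J) (z' - z)) \<le> norm (A' z - J) * norm (z' - z)" by (rule norm_blinfun)
    also have "\<dots> \<le> \<gamma> * norm (z' - z)"
      using J by (simp add: norm_minus_commute mult_right_mono)
    finally show "norm ((A' z - J) (z' - z)) \<le> \<gamma> * norm (z' - z)" .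
  qed (use \<open>0 < \<mu>\<close> in simp)
  finally show ?thesis by (simp add: algebra_simps)
qed

text \<open>Solutions have residual 0, so they lie in the sublevel set and
  \<open>r_lipschitz\<close> applies to each of them.\<close>

lemma r_le_infdist:
  assumes "solution_set A B \<noteq> {}" and x: "r x \<le> \<epsilon>"
  shows "r x \<le> (2 + L) * infdist x (solution_set A B)"
proof -
  have "r x / (2 + L) \<le> infdist x (solution_set A B)"
    unfolding infdist_notempty[OF assms(1)]
  proof (rule cINF_greatest[OF assms(1)])
    fix s assume "s \<in> solution_set A B"
    then have "r s = 0" by (simp add: residual_eq_0_iff[OF max_mono])
    then have "r x \<le> (2 + L) * norm (x - s)"
      using r_lipschitz[OF x, of s] \<epsilon>_pos by simp
    then show "r x / (2 + L) \<le> dist x s"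
      using L_nonneg by (simp add: dist_norm field_simps)
  qed
  then show ?thesis using L_nonneg by (simp add: field_simps)
qed

end

section \<open>Rates and convergence\<close>

lemma tendsto_mult_powr_at_right_0:
  fixes C a :: real
  assumes "0 < a"
  shows "((\<lambda>x. C * x powr a) \<longlongrightarrow> 0) (at_right 0)"
proof -
  have "((\<lambda>x::real. x powr a) \<longlongrightarrow> 0 powr a) (at_right 0)"
    by (rule tendsto_powr') (use assms in \<open>auto simp: eventually_at_right_field intro: exI[of _ 1]\<close>)
  then show ?thesis using tendsto_mult_right_zero by simp
qed

text \<open>The bound of \<open>newton_step_length\<close> with \<open>x\<close> for the residual,
  \<open>W = 2 * \<kappa> * x powr q\<close>, \<open>E = \<nu> * x powr (1 + \<rho>)\<close> and
  both \<open>\<mu>\<close> and \<open>\<gamma>\<close> of order \<open>x powr \<rho>\<close>. After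
  division by \<open>\<mu>\<close> every exponent is at least \<open>m\<close>, and
  \<open>x \<le> 1\<close>.\<close>

lemma step_length_rate:
  fixes x c \<nu> \<kappa> \<rho> q p m k L \<zeta> :: real
  assumes x: "0 < x" "x \<le> 1" and "0 < c" "0 \<le> \<nu>" "0 < \<kappa>" "0 \<le> \<rho>" "0 \<le> k" "0 \<le> L" "0 \<le> \<zeta>"
    and m: "m \<le> q" "m \<le> 1" "m \<le> q + p * q - \<rho>"
  shows "3 * (2 * \<kappa> * x powr q + \<nu> * x powr (1 + \<rho>)
      + ((1 + L + k * x powr \<rho>) * (\<nu> * x powr (1 + \<rho>))
         + (\<zeta> * (2 * \<kappa> * x powr q) powr (1 + p) + k * x powr \<rho> * (2 * \<kappa> * x powr q))) / (c * x powr \<rho>))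
    \<le> 3 * (2 * \<kappa> + \<nu> + ((1 + L + k) * \<nu> + (\<zeta> * (2 * \<kappa>) powr (1 + p) + k * (2 * \<kappa>))) / c) * x powr m"
proof -
  have X: "x powr q \<le> x powr m" "x powr (1 + \<rho>) \<le> x powr m" "x powr 1 \<le> x powr m"
      "x powr (q + p * q - \<rho>) \<le> x powr m"
    by (rule powr_mono'; use x m \<open>0 \<le> \<rho>\<close> in simp)+
  have rho: "x powr \<rho> \<le> 1" using x \<open>0 \<le> \<rho>\<close> by (simp add: powr_le1)
  have eq: "((1 + L + k * x powr \<rho>) * (\<nu> * x powr (1 + \<rho>))
         + (\<zeta> * (2 * \<kappa> * x powr q) powr (1 + p) + k * x powr \<rho> * (2 * \<kappa> * x powr q))) / (c * x powr \<rho>)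
    = ((1 + L + k * x powr \<rho>) * \<nu> * x powr 1
        + (\<zeta> * (2 * \<kappa>) powr (1 + p) * x powr (q + p * q - \<rho>) + k * (2 * \<kappa>) * x powr q)) / c"
    using \<open>0 < c\<close> x
    by (simp add: powr_mult powr_powr powr_add powr_diff abs_mult field_simps)
  define C where "C = ((1 + L + k) * \<nu> + (\<zeta> * (2 * \<kappa>) powr (1 + p) + k * (2 * \<kappa>))) / c"
  have "((1 + L + k * x powr \<rho>) * \<nu> * x powr 1
        + (\<zeta> * (2 * \<kappa>) powr (1 + p) * x powr (q + p * q - \<rho>) + k * (2 * \<kappa>) * x powr q)) / c
    \<le> ((1 + L + k * 1) * \<nu> * x powr m
        + (\<zeta> * (2 * \<kappa>) powr (1 + p) * x powr m + k * (2 * \<kappa>) * x powr m)) / c"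
    using X rho assms by (intro divide_right_mono add_mono mult_mono mult_left_mono) auto
  also have "\<dots> = C * x powr m"
    by (simp add: C_def algebra_simps)
  finally have le: "((1 + L + k * x powr \<rho>) * \<nu> * x powr 1
        + (\<zeta> * (2 * \<kappa>) powr (1 + p) * x powr (q + p * q - \<rho>) + k * (2 * \<kappa>) * x powr q)) / c
    \<le> C * x powr m" .
  have "2 * \<kappa> * x powr q \<le> 2 * \<kappa> * x powr m" "\<nu> * x powr (1 + \<rho>) \<le> \<nu> * x powr m"
    using X assms by (auto intro!: mult_left_mono)
  note sum_le = add_mono[OF add_mono[OF this] le]
  have "3 * (2 * \<kappa> + \<nu> + C) * x powr m
      = 3 * (2 * \<kappa> * x powr m + \<nu> * x powr m + C * x powr m)"
    by (simp only: distrib_right distrib_left mult.assoc)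
  then show ?thesis
    unfolding eq C_def[symmetric] using mult_left_mono[OF sum_le, of 3] by (simp only:)
qed

section \<open>Decay of the residual along the iteration\<close>

lemma damped_newton_sequence_stop:
  assumes "damped_newton_sequence A A' B c \<nu> \<rho> \<theta> K J x" "residual A B (x t) = 0"
  shows "x (Suc t) = x t"
  using assms(1)[unfolded damped_newton_sequence_def, rule_format, of t] assms(2) by simp

context residual_sublevel
begin

text \<open>The threshold and the constants are chosen before \<open>z\<close>, \<open>z'\<close>
  and \<open>J\<close>, so one choice serves all steps of all sequences.\<close>

lemma newton_step_rates:
  fixes c \<nu> \<rho> \<theta> K \<kappa> q :: real
  assumes S: "solution_set A B \<noteq> {}"
    and params: "0 < c" "0 \<le> \<nu>" "\<rho> \<le> \<theta>" "0 < \<kappa>" "0 < q"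
    and error_bound: "\<And>x. r x \<le> \<epsilon> \<Longrightarrow> infdist x (solution_set A B) \<le> \<kappa> * r x powr q"
    and exps: "1 < (1 + p) * q" "1 < (q + p * q - \<rho>) * (1 + p)" "1 < \<rho> + q" "0 < \<rho>"
  obtains \<delta> D m where "0 < \<delta>" "0 < m"
    and "\<And>z z' J. 0 < r z \<Longrightarrow> r z \<le> \<delta> \<Longrightarrow> psd_operator J \<Longrightarrow>
          norm (J - A' z) \<le> K * r z powr \<theta> \<Longrightarrow>
          subproblem_residual A B (damped_operator A B c \<rho> J z) z z' \<le> \<nu> * r z powr (1 + \<rho>) \<Longrightarrow>
          norm (z' - z) \<le> D * r z powr m \<and> r z' \<le> r z / 2"
proof -
  define m where "m = min q (min 1 (q + p * q - \<rho>))"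
  define k where "k = \<bar>K\<bar>"
  define D where "D = 3 * (2 * \<kappa> + \<nu>
      + ((1 + L + k) * \<nu> + (\<zeta> * (2 * \<kappa>) powr (1 + p) + k * (2 * \<kappa>))) / c)"
  have k: "0 \<le> k" by (simp add: k_def)
  have D: "0 \<le> D"
    using params k L_nonneg \<zeta>_nonneg by (auto simp: D_def intro!: add_nonneg_nonneg)
  have q': "0 < q + p * q - \<rho>"
    using exps(2) p_pos by (smt (verit) mult_nonpos_nonneg)
  have m: "m \<le> q" "m \<le> 1" "m \<le> q + p * q - \<rho>" "0 < m"
    using params q' by (auto simp: m_def)
  \<comment> \<open>Each candidate for \<open>m\<close> has its own reason: \<open>q\<close> uses
    \<open>1 < \<rho> + q\<close>, the value 1 uses \<open>0 < \<rho>\<close>, and the third uses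
    \<open>1 < (1 + p) * q\<close>.\<close>
  have e1: "0 < \<rho> + m - 1" using exps by (auto simp: m_def min_def algebra_simps)
  have e2: "0 < m * (1 + p) - 1"
    using exps p_pos by (auto simp: m_def min_def algebra_simps)
  \<comment> \<open>\<open>x * ?g x\<close> will bound the new residual when the old one is
    \<open>x\<close>. All three exponents in \<open>?g\<close> are positive.\<close>
  let ?g = "\<lambda>x. \<nu> * x powr \<rho> + (c + k) * D * x powr (\<rho> + m - 1)
      + \<zeta> * D powr (1 + p) * x powr (m * (1 + p) - 1)"
  have "(?g \<longlongrightarrow> 0 + 0 + 0) (at_right 0)"
    by (intro tendsto_add tendsto_mult_powr_at_right_0 exps e1 e2)
  then have "\<forall>\<^sub>F x in at_right 0. ?g x < 1 / 2"
    by (rule order_tendstoD) simp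
  moreover have "\<forall>\<^sub>F x in at_right 0. (2 + L) * (2 * \<kappa>) * x powr q < \<epsilon> / 2"
    using tendsto_mult_powr_at_right_0[OF \<open>0 < q\<close>] by (rule order_tendstoD) (use \<epsilon>_pos in simp)
  moreover have "\<forall>\<^sub>F x in at_right 0. (2 + L) * D * x powr m < \<epsilon> / 2"
    using tendsto_mult_powr_at_right_0[OF \<open>0 < m\<close>] by (rule order_tendstoD) (use \<epsilon>_pos in simp)
  moreover have "\<forall>\<^sub>F x in at_right 0. x < min 1 (\<epsilon> / 2)"
    using \<epsilon>_pos by (auto simp: eventually_at_right_field intro!: exI[of _ "min 1 (\<epsilon> / 2)"])
  \<comment> \<open>In order: the residual halves, the chosen solution is near, the step is short,
    and the residual is below 1 and in the half sublevel.\<close>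
  ultimately have "\<forall>\<^sub>F x in at_right 0. ?g x < 1 / 2 \<and> (2 + L) * (2 * \<kappa>) * x powr q < \<epsilon> / 2
      \<and> (2 + L) * D * x powr m < \<epsilon> / 2 \<and> x < min 1 (\<epsilon> / 2)"
    by eventually_elim auto
  then obtain b :: real where "0 < b" and b: "\<And>x. 0 < x \<Longrightarrow> x < b \<Longrightarrow> ?g x < 1 / 2 \<and>
      (2 + L) * (2 * \<kappa>) * x powr q < \<epsilon> / 2 \<and> (2 + L) * D * x powr m < \<epsilon> / 2 \<and> x < min 1 (\<epsilon> / 2)"
    unfolding eventually_at_right_field by auto
  show thesis
  proof (rule that[of "b / 2" m D])
    show "0 < b / 2" using \<open>0 < b\<close> by simp
    show "0 < m" by fact
    fix z z' J
    assume z: "0 < r z" "r z \<le> b / 2" and J: "psd_operator J" "norm (J - A' z) \<le> K * r z powr \<theta>"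
      and sub: "subproblem_residual A B (damped_operator A B c \<rho> J z) z z' \<le> \<nu> * r z powr (1 + \<rho>)"
    define x where "x = r z"
    have x: "0 < x" "x \<le> 1" "x \<le> \<epsilon> / 2" "(2 + L) * (2 * \<kappa>) * x powr q < \<epsilon> / 2"
        "(2 + L) * D * x powr m < \<epsilon> / 2" and g: "?g x < 1 / 2"
      using b[of x] z \<open>0 < b\<close> by (auto simp: x_def)
    have J': "norm (J - A' z) \<le> k * x powr \<rho>"
    proof -
      \<comment> \<open>The sign of \<open>K\<close> is free, hence the absolute value;
        \<open>x \<le> 1\<close> allows lowering \<open>\<theta>\<close> to
        \<open>\<rho>\<close>.\<close>
      have "K * x powr \<theta> \<le> k * x powr \<theta>" by (auto simp: k_def intro: mult_right_mono)
      also have "\<dots> \<le> k * x powr \<rho>"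
        using x k params by (intro mult_left_mono powr_mono') auto
      finally show ?thesis using J(2) by (simp add: x_def)
    qed
    have \<mu>: "0 < c * x powr \<rho>" using x params by simp
    have sub': "subproblem_residual A B ((c * x powr \<rho>) *\<^sub>R id_blinfun + J) z z' \<le> \<nu> * x powr (1 + \<rho>)"
      using sub by (simp add: damped_operator_def x_def)
    have z': "r z \<le> \<epsilon> / 2" using x by (simp add: x_def)
    \<comment> \<open>Doubling \<open>\<kappa>\<close> makes the inequality strict, so some solution
      is that close even if the infimum is not attained.\<close>
    have "infdist z (solution_set A B) < 2 * \<kappa> * x powr q"
    proof -
      have "infdist z (solution_set A B) \<le> \<kappa> * x powr q"
        using error_bound[of z] z' \<epsilon>_pos by (simp add: x_def)
      also have "\<dots> < 2 * \<kappa> * x powr q" using x params by simp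
      finally show ?thesis .
    qed
    then obtain s where s: "s \<in> solution_set A B" "dist z s < 2 * \<kappa> * x powr q"
      unfolding infdist_notempty[OF S] by (subst (asm) cINF_less_iff[OF S]) auto
    have sW: "norm (s - z) \<le> 2 * \<kappa> * x powr q"
      using s(2) by (simp add: dist_norm norm_minus_commute)
    then have "(2 + L) * norm (s - z) \<le> (2 + L) * (2 * \<kappa> * x powr q)"
      using L_nonneg by (intro mult_left_mono) auto
    then have s_near: "(2 + L) * norm (s - z) < \<epsilon> / 2" using x(4) by (simp add: mult.assoc)
    have d: "norm (z' - z) \<le> D * x powr m"
      using newton_step_length[OF z' J(1) J' \<mu> sub' s(1) s_near sW]
        step_length_rate[OF x(1,2) params(1,2,4) less_imp_le[OF exps(4)] k L_nonneg \<zeta>_nonneg m(1-3)]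
      unfolding D_def by linarith
    then have "(2 + L) * norm (z' - z) \<le> (2 + L) * (D * x powr m)"
      using L_nonneg by (intro mult_left_mono) auto
    then have d_near: "(2 + L) * norm (z' - z) < \<epsilon> / 2" using x(5) by (simp add: mult.assoc)
    have "r z' \<le> \<nu> * x powr (1 + \<rho>) + (c * x powr \<rho> + k * x powr \<rho>) * norm (z' - z)
        + \<zeta> * norm (z' - z) powr (1 + p)"
      by (rule newton_step_residual[OF z' J' \<mu> sub' d_near])
    also have "\<dots> \<le> \<nu> * x powr (1 + \<rho>) + (c * x powr \<rho> + k * x powr \<rho>) * (D * x powr m)
        + \<zeta> * (D * x powr m) powr (1 + p)"
      using d params exps x k p_pos \<zeta>_nonneg by (intro add_mono mult_left_mono powr_mono2) auto
    also have "\<dots> = x * ?g x"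
      using x by (simp add: powr_mult powr_powr powr_add powr_diff abs_mult field_simps)
    also have "\<dots> \<le> x * (1 / 2)"
      using x g by (intro mult_left_mono) auto
    finally show "norm (z' - z) \<le> D * r z powr m \<and> r z' \<le> r z / 2"
      using d by (simp add: x_def)
  qed
qed

text \<open>Halving keeps the residual below \<open>\<delta>\<close> and bounds the steps by a
  geometric series of ratio \<open>(1 / 2) powr m\<close>. The limit is a solution because
  \<open>r\<close> is continuous.\<close>

lemma convergent_of_step_rates:
  assumes "0 < m" and "r (x 0) \<le> \<delta>"
    and step: "\<And>t. r (x t) \<le> \<delta> \<Longrightarrow>
      norm (x (Suc t) - x t) \<le> D * r (x t) powr m \<and> r (x (Suc t)) \<le> r (x t) / 2"
  shows "\<exists>x_star \<in> solution_set A B. x \<longlonglongrightarrow> x_star"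
proof -
  have r0: "0 \<le> r (x 0)" by (rule residual_nonneg)
  have half_le: "r (x 0) * (1 / 2) ^ t \<le> r (x 0)" for t :: nat
    using r0 by (simp add: mult_left_le power_le_one)
  have r_le: "r (x t) \<le> r (x 0) * (1 / 2) ^ t" for t
  proof (induction t)
    case (Suc t)
    with half_le[of t] assms(2) have "r (x t) \<le> \<delta>" by linarith
    with step Suc show ?case by fastforce
  qed simp
  have r_lim: "(\<lambda>t. r (x t)) \<longlonglongrightarrow> 0"
  proof (rule tendsto_sandwich[of "\<lambda>_. 0"])
    show "(\<lambda>t. r (x 0) * (1 / 2) ^ t) \<longlonglongrightarrow> 0"
      by (intro tendsto_mult_right_zero LIMSEQ_realpow_zero) auto
  qed (use r_le in \<open>simp_all add: residual_nonneg\<close>)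
  define C where "C = \<bar>D\<bar> * r (x 0) powr m"
  have "norm (x (Suc t) - x t) \<le> C * ((1 / 2) powr m) ^ t" for t
  proof -
    have "norm (x (Suc t) - x t) \<le> D * r (x t) powr m"
      using step[of t] r_le[of t] half_le[of t] assms(2) by linarith
    also have "\<dots> \<le> \<bar>D\<bar> * r (x t) powr m" by (intro mult_right_mono) auto
    also have "\<dots> \<le> \<bar>D\<bar> * (r (x 0) * (1 / 2) ^ t) powr m"
      using r_le residual_nonneg \<open>0 < m\<close> by (intro mult_left_mono powr_mono2) auto
    also have "\<dots> = C * ((1 / 2) powr m) ^ t"
      by (simp add: C_def powr_mult powr_powr powr_realpow[symmetric] mult.commute)
    finally show ?thesis .
  qed
  moreover have "summable (\<lambda>t. C * ((1 / 2) powr m) ^ t)"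
    using \<open>0 < m\<close> by (intro summable_mult summable_geometric) (use powr_less_mono2[of m "1 / 2" 1] in simp)
  ultimately have "Cauchy x" by (rule Cauchy_of_summable_steps)
  then obtain l where l: "x \<longlonglongrightarrow> l" by (auto simp: Cauchy_convergent_iff convergent_def)
  have "(\<lambda>t. r (x t)) \<longlonglongrightarrow> r l"
    using continuous_on_tendsto_compose[OF continuous_on_r l] by simp
  with r_lim have "r l = 0" using LIMSEQ_unique by blast
  with l show ?thesis by (auto simp: residual_eq_0_iff[OF max_mono])
qed

text \<open>The error bound and \<open>r_le_infdist\<close> bound \<open>r x\<close> by
  \<open>r x\<close> times a multiple of \<open>r x powr (q - 1)\<close>, a factor below 1 when
  \<open>r x\<close> is small and positive.\<close>

lemma small_residual_eq_0:
  assumes "solution_set A B \<noteq> {}" and "1 < q"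
    and error_bound: "\<And>x. r x \<le> \<epsilon> \<Longrightarrow> infdist x (solution_set A B) \<le> \<kappa> * r x powr q"
  obtains \<delta> where "0 < \<delta>" "\<And>x. r x \<le> \<delta> \<Longrightarrow> r x = 0"
proof -
  have "\<forall>\<^sub>F y in at_right 0. (2 + L) * \<kappa> * y powr (q - 1) < 1"
    by (rule order_tendstoD[OF tendsto_mult_powr_at_right_0]) (use \<open>1 < q\<close> in auto)
  then obtain b :: real where "0 < b" and b: "\<And>y. 0 < y \<Longrightarrow> y < b \<Longrightarrow> (2 + L) * \<kappa> * y powr (q - 1) < 1"
    unfolding eventually_at_right_field by auto
  show thesis
  proof (rule that[of "min \<epsilon> (b / 2)"])
    show "0 < min \<epsilon> (b / 2)" using \<open>0 < b\<close> \<epsilon>_pos by simp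
    fix x assume x: "r x \<le> min \<epsilon> (b / 2)"
    show "r x = 0"
    proof (rule ccontr)
      assume "r x \<noteq> 0"
      then have "0 < r x" using residual_nonneg[of A B x] by simp
      have "r x \<le> (2 + L) * infdist x (solution_set A B)"
        using r_le_infdist[OF assms(1)] x by simp
      also have "\<dots> \<le> (2 + L) * (\<kappa> * r x powr q)"
        using error_bound[of x] x L_nonneg by (intro mult_left_mono) auto
      also have "\<dots> = r x * ((2 + L) * \<kappa> * r x powr (q - 1))"
        using \<open>0 < r x\<close> by (simp add: powr_diff)
      also have "\<dots> < r x * 1"
        using b[of "r x"] x \<open>0 < b\<close> \<open>0 < r x\<close> by (intro mult_strict_left_mono) auto
      finally show False by simp
    qed
  qed
qed

end

theorem theorem2p5:
  fixes A :: "'a::{real_inner,complete_space} \<Rightarrow> 'a"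
    and A' :: "'a \<Rightarrow> ('a \<Rightarrow>\<^sub>L 'a)"
    and B :: "'a \<Rightarrow> 'a set"
    and c \<nu> \<rho> \<theta> K \<epsilon> \<kappa> q L \<zeta> p :: real
  assumes deriv_A: "\<And>x. (A has_derivative blinfun_apply (A' x)) (at x)"
    and cont_A': "continuous_on UNIV A'"
    and max_mono_B: "maximal_monotone B"
    and S_nonempty: "solution_set A B \<noteq> {}"
    and S_closed: "closed (solution_set A B)"
    and params: "c > 0" "\<nu> \<ge> 0" "\<rho> \<ge> 0" "\<theta> \<ge> \<rho>"
    and error_bound_params: "\<epsilon> > 0" "\<kappa> > 0" "q > 0"
    and error_bound: "\<And>x. residual A B x \<le> \<epsilon> \<Longrightarrow>
          infdist x (solution_set A B) \<le> \<kappa> * residual A B x powr q"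
    and lipschitz_A: "L \<ge> 0" "L-lipschitz_on {x. residual A B x \<le> \<epsilon>} A"
    and holder_params: "0 < p" "p \<le> 1" "\<zeta> \<ge> 0"
    and holder_A': "\<And>x y. residual A B x \<le> \<epsilon> \<Longrightarrow> residual A B y \<le> \<epsilon> \<Longrightarrow>
          norm (A' x - A' y) \<le> \<zeta> * norm (x - y) powr p"
    and exponents:
      "((1 + \<rho>) * q > 1 \<and> (1 + p) * q > 1 \<and> (q + p * q - \<rho>) * (1 + p) > 1) \<or>
       ((1 + p) * q > 1 \<and> (q + p * q - \<rho>) * (1 + p) > 1 \<and> \<rho> + q > 1 \<and> \<rho> > 0)"
  shows "\<exists>\<delta>>0. \<forall>J x.
           damped_newton_sequence A A' B c \<nu> \<rho> \<theta> K J x \<and> residual A B (x 0) \<le> \<delta> \<longrightarrow>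
           (\<exists>x_star \<in> solution_set A B. x \<longlonglongrightarrow> x_star)"
proof -
  interpret residual_sublevel A A' B \<epsilon> L \<zeta> p
    using deriv_A max_mono_B error_bound_params lipschitz_A holder_params holder_A'
    by unfold_locales auto
  show ?thesis
  \<comment> \<open>If \<open>1 < q\<close>, a small initial residual is already 0 and the sequence
    is constant. This includes condition (i) with \<open>\<rho> = 0\<close>.\<close>
  proof (cases "1 < q")
    case True
    obtain \<delta> where "0 < \<delta>" and \<delta>: "\<And>x. r x \<le> \<delta> \<Longrightarrow> r x = 0"
      using small_residual_eq_0[OF S_nonempty True error_bound] by blast
    show ?thesis
    proof (intro exI[of _ \<delta>] conjI allI impI \<open>0 < \<delta>\<close>)
      fix J x
      assume x: "damped_newton_sequence A A' B c \<nu> \<rho> \<theta> K J x \<and> r (x 0) \<le> \<delta>"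
      have "r (x t) = 0 \<and> x t = x 0" for t
      proof (induction t)
        case (Suc t)
        then have "x (Suc t) = x t" using x damped_newton_sequence_stop by blast
        with Suc show ?case by metis
      qed (use \<delta> x in simp)
      then have "x = (\<lambda>_. x 0)" "r (x 0) = 0" by auto
      then show "\<exists>x_star \<in> solution_set A B. x \<longlonglongrightarrow> x_star"
        by (metis residual_eq_0_iff[OF max_mono] tendsto_const)
    qed
  next
    case False
    have exps: "1 < (1 + p) * q" "1 < (q + p * q - \<rho>) * (1 + p)" "1 < \<rho> + q" "0 < \<rho>"
    proof -
      \<comment> \<open>For \<open>q \<le> 1\<close> this turns \<open>(1 + \<rho>) * q > 1\<close>
        into \<open>\<rho> + q > 1\<close>, which in turn forces \<open>\<rho> > 0\<close>.\<close>
      have "\<rho> * q \<le> \<rho>" using False params by (simp add: mult_left_le)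
      then show "1 < \<rho> + q" using exponents by (auto simp: algebra_simps)
      with False show "0 < \<rho>" using params by auto
    qed (use exponents in auto)
    obtain \<delta> D m where "0 < \<delta>" "0 < m"
      and step: "\<And>z z' J. 0 < r z \<Longrightarrow> r z \<le> \<delta> \<Longrightarrow> psd_operator J \<Longrightarrow>
          norm (J - A' z) \<le> K * r z powr \<theta> \<Longrightarrow>
          subproblem_residual A B (damped_operator A B c \<rho> J z) z z' \<le> \<nu> * r z powr (1 + \<rho>) \<Longrightarrow>
          norm (z' - z) \<le> D * r z powr m \<and> r z' \<le> r z / 2"
      using newton_step_rates[OF S_nonempty params(1,2,4) error_bound_params(2,3) error_bound exps]
      by metis
    show ?thesis
    proof (intro exI[of _ \<delta>] conjI allI impI \<open>0 < \<delta>\<close>)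
      fix J x
      assume x: "damped_newton_sequence A A' B c \<nu> \<rho> \<theta> K J x \<and> r (x 0) \<le> \<delta>"
      show "\<exists>x_star \<in> solution_set A B. x \<longlonglongrightarrow> x_star"
      proof (rule convergent_of_step_rates[OF \<open>0 < m\<close>])
        show "r (x 0) \<le> \<delta>" using x by simp
        fix t assume t: "r (x t) \<le> \<delta>"
        show "norm (x (Suc t) - x t) \<le> D * r (x t) powr m \<and> r (x (Suc t)) \<le> r (x t) / 2"
        proof (cases "r (x t) = 0")
          case True
          then have "x (Suc t) = x t" using x damped_newton_sequence_stop by blast
          \<comment> \<open>All four quantities vanish, since \<open>0 powr m = 0\<close>.\<close>
          with True show ?thesis by simp
        next
          case False
          then have "0 < r (x t)" using residual_nonneg[of A B "x t"] by simp
          with False x t show ?thesis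
            unfolding damped_newton_sequence_def by (intro step[of "x t" "J t"]) auto
        qed
      qed
    qed
  qed
qed

end
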